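(* Let $H$ be a real Hilbert space, $C\subseteq H$ a nonempty closed convex set, and $F\colon H\to H$ a mapping that is monotone ($\langle F(x)-F(y),x-y\rangle\ge0$ for all $x,y$) and Lipschitz continuous with constant $L>0$, and assume the solution set $S$ of the variational inequality "find $x^*\in C$ with $\langle F(x^* ),x-x^*\rangle\ge0$ for all $x\in C$" is nonempty. Then any sequences $(x_n)$ and $(y_n)$ generated by Algorithm A (described below) converge weakly to a solution of this variational inequality.
   Context: Convention: $0/0=+\infty$ and $1/0=+\infty$. $P_C$ is the metric projection onto $C$. Algorithm A: Step 1. Choose $x_0\in C$, $\lambda_{-1}>0$, $\theta_0=1$, $\alpha\in(0,\sqrt2-1)$ and $\bar\lambda>0$. Compute $y_0=P_C(x_0-\lambda_{-1}F(x_0))$, $\lambda_0=\min\{\alpha\|x_0-y_0\|/\|F(x_0)-F(y_0)\|,\bar\lambda\}$, $x_1=P_C(x_0-\lambda_0F(y_0))$. Step 2 (for $n\ge1$). Set $\theta_n=1$ and define, for $y\in H$, $\theta>0$, $\lambda(y,\theta)=\min\{\alpha\|y-y_{n-1}\|/\|F(y)-F(y_{n-1})\|,\ \frac{1+\theta_{n-1}}{\theta}\lambda_{n-1},\ \bar\lambda\}$. Compute $y_n=2x_n-x_{n-1}$, $\lambda_n=\lambda(y_n,\theta_n)$, $x_{n+1}=P_C(x_n-\lambda_nF(y_n))$. Step 3. If $\|y_n-P_C(x_n-\lambda_nF(y_n))\|+\|x_n-y_n\|=0$, stop ($x_n$ is a solution). Otherwise compute $t_n=-\|x_{n+1}-x_n\|^2+2\lambda_n\langle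 F(y_n),y_n-x_{n+1}\rangle+(1-\alpha(1+\sqrt2))\|x_n-y_n\|^2-\alpha\|x_n-y_{n-1}\|^2+(1-\sqrt2\alpha)\|x_{n+1}-y_n\|^2$. Step 4. If $t_n\le0$, go to Step 2 with $n:=n+1$. Otherwise: (i) if $\lambda_n\ge\lambda_{n-1}$, choose $\lambda_n'\in[\lambda_{n-1},\lambda_n]$ with $\|\lambda_n'F(y_n)-\lambda_{n-1}F(y_{n-1})\|\le\alpha\|y_n-y_{n-1}\|$, recompute $x_{n+1}=P_C(x_n-\lambda_n'F(y_n))$, set $\lambda_n:=\lambda_n'$, $n:=n+1$, go to Step 2; (ii) if $\lambda_n<\lambda_{n-1}$, find $\theta_n'\in(0,1]$ such that, with $y_n'=x_n+\theta_n'(x_n-x_{n-1})$, one has $\lambda(y_n',\theta_n')\ge\theta_n'\lambda_{n-1}$; then choose $\lambda_n'\in[\theta_n'\lambda_{n-1},\lambda(y_n',\theta_n')]$ with $\|\lambda_n'F(y_n')-\theta_n'\lambda_{n-1}F(y_{n-1})\|\le\alpha\|y_n'-y_{n-1}\|$, recompute $x_{n+1}=P_C(x_n-\lambda_n'F(y_n'))$, set $\lambda_n:=\lambda_n'$, $\theta_n:=\theta_n'$, $y_n:=y_n'$, $n:=n+1$, go to Step 2. The sequences $(x_n)$, $(y_n)$ refer to the final values after any modification in Step 4. *)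

theory Defs
  imports "HOL-Analysis.Analysis"
begin

text \<open>Metric projection onto C: the (unique, for nonempty closed convex C in a
Hilbert space) nearest point of C.\<close>
definition metric_proj :: "'a::real_inner set \<Rightarrow> 'a \<Rightarrow> 'a" where
  "metric_proj C x = (SOME p. p \<in> C \<and> (\<forall>z\<in>C. norm (x - p) \<le> norm (x - z)))"

definition weakly_converges :: "(nat \<Rightarrow> 'a::real_inner) \<Rightarrow> 'a \<Rightarrow> bool" where
  "weakly_converges u p \<longleftrightarrow> (\<forall>z. (\<lambda>n. inner (u n) z) \<longlonglongrightarrow> inner p z)"

definition VI_sol :: "'a::real_inner set \<Rightarrow> ('a \<Rightarrow> 'a) \<Rightarrow> 'a set" where
  "VI_sol C F = {s \<in> C. \<forall>x\<in>C. inner (F s) (x - s) \<ge> 0}"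

text \<open>min(a/b, c) with the convention a/0 = +infinity (so the result is c when b = 0).\<close>
definition capped_ratio :: "real \<Rightarrow> real \<Rightarrow> real \<Rightarrow> real" where
  "capped_ratio a b c = (if b = 0 then c else min (a / b) c)"

definition stepfun :: "('a::real_normed_vector \<Rightarrow> 'a) \<Rightarrow> real \<Rightarrow> real \<Rightarrow> 'a \<Rightarrow> real \<Rightarrow> real
    \<Rightarrow> 'a \<Rightarrow> real \<Rightarrow> real" where
  "stepfun F alpha lbar yprev lprev thprev yy th =
     capped_ratio (alpha * norm (yy - yprev)) (norm (F yy - F yprev))
                  (min ((1 + thprev) / th * lprev) lbar)"

definition tquant :: "('a::real_inner \<Rightarrow> 'a) \<Rightarrow> real \<Rightarrow> 'a \<Rightarrow> 'a \<Rightarrow> 'a \<Rightarrow> real \<Rightarrow> 'a \<Rightarrow> real" where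
  "tquant F alpha xn yprev yn lnt xnext =
     - (norm (xnext - xn))\<^sup>2 + 2 * lnt * inner (F yn) (yn - xnext)
     + (1 - alpha * (1 + sqrt 2)) * (norm (xn - yn))\<^sup>2
     - alpha * (norm (xn - yprev))\<^sup>2
     + (1 - sqrt 2 * alpha) * (norm (xnext - yn))\<^sup>2"

text \<open>One iteration n \<ge> 1 of Algorithm A (Steps 2--4), relating the final values
x_{n-1}, x_n, y_{n-1}, lambda_{n-1}, theta_{n-1} to the final values
y_n, lambda_n, theta_n, x_{n+1}. The algorithm does not stop at this iteration
(the stopping test of Step 3 fails).\<close>
definition algA_step ::
  "'a::real_inner set \<Rightarrow> ('a \<Rightarrow> 'a) \<Rightarrow> real \<Rightarrow> real
   \<Rightarrow> 'a \<Rightarrow> 'a \<Rightarrow> 'a \<Rightarrow> real \<Rightarrow> real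
   \<Rightarrow> 'a \<Rightarrow> real \<Rightarrow> real \<Rightarrow> 'a \<Rightarrow> bool" where
  "algA_step C F alpha lbar xprev xn yprev lprev thprev yn' lnf thn' xnext' \<longleftrightarrow>
     (let lamf = stepfun F alpha lbar yprev lprev thprev;
          yn = 2 *\<^sub>R xn - xprev;
          lnt = lamf yn 1;
          xnext = metric_proj C (xn - lnt *\<^sub>R F yn);
          t = tquant F alpha xn yprev yn lnt xnext
      in norm (yn - metric_proj C (xn - lnt *\<^sub>R F yn)) + norm (xn - yn) \<noteq> 0 \<and>
         ((t \<le> 0 \<and> yn' = yn \<and> lnf = lnt \<and> thn' = 1 \<and> xnext' = xnext)
        \<or> (t > 0 \<and> lnt \<ge> lprev \<and> yn' = yn \<and> thn' = 1 \<and>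
           lprev \<le> lnf \<and> lnf \<le> lnt \<and>
           norm (lnf *\<^sub>R F yn - lprev *\<^sub>R F yprev) \<le> alpha * norm (yn - yprev) \<and>
           xnext' = metric_proj C (xn - lnf *\<^sub>R F yn))
        \<or> (t > 0 \<and> lnt < lprev \<and> 0 < thn' \<and> thn' \<le> 1 \<and>
           yn' = xn + thn' *\<^sub>R (xn - xprev) \<and>
           lamf yn' thn' \<ge> thn' * lprev \<and>
           thn' * lprev \<le> lnf \<and> lnf \<le> lamf yn' thn' \<and>
           norm (lnf *\<^sub>R F yn' - (thn' * lprev) *\<^sub>R F yprev) \<le> alpha * norm (yn' - yprev) \<and>
           xnext' = metric_proj C (xn - lnf *\<^sub>R F yn'))))"

text \<open>(x, y, lam, theta) is an (infinite, non-terminating) run of Algorithm A with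
parameters alpha, lbar, lambda_{-1} = lm1 (all sequences indexed from 0, final values).\<close>
definition algA_run ::
  "'a::real_inner set \<Rightarrow> ('a \<Rightarrow> 'a) \<Rightarrow> real \<Rightarrow> real \<Rightarrow> real
   \<Rightarrow> (nat \<Rightarrow> 'a) \<Rightarrow> (nat \<Rightarrow> 'a) \<Rightarrow> (nat \<Rightarrow> real) \<Rightarrow> (nat \<Rightarrow> real) \<Rightarrow> bool" where
  "algA_run C F alpha lbar lm1 x y lam theta \<longleftrightarrow>
     0 < alpha \<and> alpha < sqrt 2 - 1 \<and> 0 < lbar \<and> 0 < lm1 \<and>
     x 0 \<in> C \<and> theta 0 = 1 \<and>
     y 0 = metric_proj C (x 0 - lm1 *\<^sub>R F (x 0)) \<and>
     lam 0 = capped_ratio (alpha * norm (x 0 - y 0)) (norm (F (x 0) - F (y 0))) lbar \<and>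
     x 1 = metric_proj C (x 0 - lam 0 *\<^sub>R F (y 0)) \<and>
     (\<forall>n\<ge>1. algA_step C F alpha lbar (x (n - 1)) (x n) (y (n - 1)) (lam (n - 1)) (theta (n - 1))
                (y n) (lam n) (theta n) (x (Suc n)))"

end

theory Submission
  imports Defs
begin

text \<open>
  Along the iteration, the quantity
  \<open>\<parallel>x\<^sub>n\<^sub>+\<^sub>1 - z\<parallel>\<^sup>2 + 2 (1 + \<theta>\<^sub>n) \<lambda>\<^sub>n \<langle>F z, x\<^sub>n - z\<rangle> + \<alpha> \<parallel>x\<^sub>n\<^sub>+\<^sub>1 - y\<^sub>n\<parallel>\<^sup>2\<close>
  decreases for every solution \<open>z\<close>, by an amount that controls \<open>\<parallel>x\<^sub>n - y\<^sub>n\<parallel>\<^sup>2 + \<parallel>x\<^sub>n\<^sub>+\<^sub>1 - y\<^sub>n\<parallel>\<^sup>2\<close>.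
  So these squares are summable and \<open>\<parallel>x\<^sub>n - z\<parallel>\<close> converges.

  The step sizes need not be bounded away from zero, since in Step 4 (ii) the factor \<open>\<theta>\<^sub>n\<close> may be
  arbitrarily small; but they exceed a positive constant infinitely often, because Step 4 (ii) is
  entered only if \<open>\<lambda>\<^sub>n\<^sub>-\<^sub>1 > \<alpha> / L\<close>.  The residual
  \<open>g\<^sub>n\<^sub>+\<^sub>1 = (x\<^sub>n - x\<^sub>n\<^sub>+\<^sub>1) / \<lambda>\<^sub>n - F y\<^sub>n + F x\<^sub>n\<^sub>+\<^sub>1\<close> lies in \<open>(F + N\<^sub>C) x\<^sub>n\<^sub>+\<^sub>1\<close>, where \<open>N\<^sub>C\<close> is the
  normal cone, and monotonicity of \<open>F + N\<^sub>C\<close> gives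
  \<open>\<parallel>g\<^sub>n\<^sub>+\<^sub>1\<parallel>\<^sup>2 \<le> \<parallel>g\<^sub>n\<parallel>\<^sup>2 + L\<^sup>2 \<parallel>x\<^sub>n\<^sub>+\<^sub>1 - y\<^sub>n\<parallel>\<^sup>2\<close> whatever the step sizes are.  Hence \<open>g\<^sub>n \<rightarrow> 0\<close>
  along the whole sequence, and Minty's lemma and Opial's argument finish the proof.
\<close>

section \<open>Projections and weak convergence in Hilbert spaces\<close>

lemma infdist_almost_attained:
  assumes "S \<noteq> {}" "infdist v S < e"
  shows "\<exists>z\<in>S. dist v z < e"
  using assms cInf_less_iff[of "(\<lambda>z. dist v z) ` S" e]
  by (auto simp: infdist_notempty intro: bdd_belowI2[where m = 0])

text \<open>This takes the place of weak compactness of bounded sets: it yields both the existence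
  of projections and the cluster points in Opial's argument. Points of nearly minimal norm in the
  sets form a Cauchy sequence, because the distances of the sets from 0 increase to a limit.\<close>

lemma nested_closed_convex_Inter_nonempty:
  fixes K :: "nat \<Rightarrow> 'a::{real_inner, complete_space} set"
  assumes ne: "\<And>n. K n \<noteq> {}" and cl: "\<And>n. closed (K n)" and cv: "\<And>n. convex (K n)"
    and dec: "\<And>m n. n \<le> m \<Longrightarrow> K m \<subseteq> K n" and bd: "bounded (K 0)"
  shows "(\<Inter>n. K n) \<noteq> {}"
proof -
  define d where "d n = infdist 0 (K n)" for n
  have d_le: "d n \<le> norm v" if "v \<in> K n" for n v
    using infdist_le[OF that, of 0] by (simp add: d_def)
  have "\<exists>v\<in>K n. norm v < d n + 1 / real (Suc n)" for n
    using infdist_almost_attained[of "K n" 0 "d n + 1 / real (Suc n)"] ne[of n]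
    by (auto simp: d_def)
  then obtain u where uK: "\<And>n. u n \<in> K n" and u_less: "\<And>n. norm (u n) < d n + 1 / real (Suc n)"
    by metis
  obtain B where B: "\<And>v. v \<in> K 0 \<Longrightarrow> norm v \<le> B"
    using bd by (auto simp: bounded_iff)
  have d_mono: "d n \<le> d m" if "n \<le> m" for n m
    unfolding d_def by (rule infdist_mono[OF dec[OF that] ne])
  have d_nn: "0 \<le> d n" for n
    by (simp add: d_def infdist_nonneg)
  have d_B: "d n \<le> B" for n
    using d_le[OF uK, of n] B[of "u n"] uK[of n] dec[of 0 n] by (auto intro: order_trans)
  have "incseq d"
    using d_mono by (simp add: incseq_def)
  then obtain D where D: "d \<longlonglongrightarrow> D" and dD: "\<And>n. d n \<le> D"
    using incseq_convergent[of d B] d_B by auto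
  have tend: "(\<lambda>n. (D + 1 / real (Suc n))\<^sup>2 - (d n)\<^sup>2) \<longlonglongrightarrow> (D + 0)\<^sup>2 - D\<^sup>2"
    by (intro tendsto_intros D LIMSEQ_Suc[OF lim_1_over_n])
  have close: "(norm (u m - u n))\<^sup>2 \<le> 4 * ((D + 1 / real (Suc n))\<^sup>2 - (d n)\<^sup>2)" if "n \<le> m" for m n
  proof -
    \<comment> \<open>The midpoint lies in the convex set \<open>K n\<close>, so its norm is at
      least \<open>d n\<close>. Hence \<open>u n + u m\<close> is long, and the parallelogram law
      forces \<open>u m - u n\<close> to be short.\<close>
    have "(1/2) *\<^sub>R u n + (1/2) *\<^sub>R u m \<in> K n"
      using uK dec[OF that] cv[of n] by (intro convexD) auto
    then have "d n \<le> norm ((1/2) *\<^sub>R (u n + u m))"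
      by (intro d_le) (simp add: scaleR_add_right)
    then have "(2 * d n)\<^sup>2 \<le> (norm (u n + u m))\<^sup>2"
      by (intro power_mono) (simp_all add: d_nn)
    moreover have "norm (u n) \<le> D + 1 / real (Suc n)"
      using u_less[of n] dD[of n] by simp
    moreover have "norm (u m) \<le> D + 1 / real (Suc n)"
      using u_less[of m] dD[of m] that frac_le[of 1 1 "real (Suc n)" "real (Suc m)"] by simp
    ultimately have "(2 * d n)\<^sup>2 \<le> (norm (u n + u m))\<^sup>2"
      "(norm (u n))\<^sup>2 \<le> (D + 1 / real (Suc n))\<^sup>2" "(norm (u m))\<^sup>2 \<le> (D + 1 / real (Suc n))\<^sup>2"
      by (auto intro: power_mono)
    moreover have "(norm (u m - u n))\<^sup>2 + (norm (u n + u m))\<^sup>2 = 2 * (norm (u n))\<^sup>2 + 2 * (norm (u m))\<^sup>2"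
      by (simp add: power2_norm_eq_inner algebra_simps inner_commute)
    ultimately show ?thesis
      by (simp add: power_mult_distrib)
  qed
  have "Cauchy u"
  proof (rule CauchyI')
    fix e :: real assume e: "0 < e"
    have "eventually (\<lambda>n. (D + 1 / real (Suc n))\<^sup>2 - (d n)\<^sup>2 < e\<^sup>2 / 4) sequentially"
      using order_tendstoD(2)[OF tend, of "e\<^sup>2 / 4"] e by simp
    then obtain N where N: "\<And>n. n \<ge> N \<Longrightarrow> (D + 1 / real (Suc n))\<^sup>2 - (d n)\<^sup>2 < e\<^sup>2 / 4"
      by (auto simp: eventually_sequentially)
    have "norm (u m - u n) < e" if "N \<le> m" "m < n" for m n
    proof (rule power_less_imp_less_base)
      have "m \<le> n" using that by simp
      then show "(norm (u m - u n))\<^sup>2 < e\<^sup>2"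
        using close[of m n] N[OF that(1)] by (simp add: norm_minus_commute[of "u m"])
      show "0 \<le> e" using e by simp
    qed
    then show "\<exists>N. \<forall>m\<ge>N. \<forall>n>m. dist (u m) (u n) < e"
      by (auto simp: dist_norm)
  qed
  then obtain p where p: "u \<longlonglongrightarrow> p"
    using Cauchy_convergent convergent_def by blast
  have "p \<in> K n" for n
  proof (rule Lim_in_closed_set[OF cl _ _ p])
    show "eventually (\<lambda>m. u m \<in> K n) sequentially"
      unfolding eventually_sequentially using uK dec by blast
  qed simp
  then show ?thesis by blast
qed

text \<open>The intersections of \<open>C\<close> with balls about \<open>v\<close> whose radii
  shrink to the distance are nested. A common point attains the distance, so the choice in
  \<open>metric_proj\<close> is meaningful.\<close>

lemma metric_proj_nearest:
  fixes C :: "'a::{real_inner, complete_space} set"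
  assumes "C \<noteq> {}" "closed C" "convex C"
  shows "metric_proj C v \<in> C \<and> (\<forall>z\<in>C. norm (v - metric_proj C v) \<le> norm (v - z))"
proof -
  define K where "K n = C \<inter> cball v (infdist v C + 1 / real (Suc n))" for n :: nat
  have "(\<Inter>n. K n) \<noteq> {}"
  proof (rule nested_closed_convex_Inter_nonempty)
    show "K n \<noteq> {}" for n
      using infdist_almost_attained[of C v "infdist v C + 1 / real (Suc n)"] assms(1)
      by (auto simp: K_def intro: less_imp_le)
    show "K m \<subseteq> K n" if "n \<le> m" for m n
      using that frac_le[of 1 1 "real (Suc n)" "real (Suc m)"] by (auto simp: K_def)
  qed (use assms in \<open>auto simp: K_def intro: bounded_Int closed_Int convex_Int\<close>)
  then obtain p where p: "p \<in> C" "\<And>n::nat. dist v p \<le> infdist v C + 1 / real (Suc n)"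
    unfolding K_def by fastforce
  have "(\<lambda>n. infdist v C + 1 / real (Suc n)) \<longlonglongrightarrow> infdist v C + 0"
    by (intro tendsto_intros LIMSEQ_Suc[OF lim_1_over_n])
  then have "dist v p \<le> infdist v C"
    using LIMSEQ_le_const[of _ "infdist v C + 0" "dist v p"] p(2) by auto
  then have "\<forall>z\<in>C. norm (v - p) \<le> norm (v - z)"
    using infdist_le[of _ C v] by (force simp: dist_norm)
  then show ?thesis
    unfolding metric_proj_def using p(1)
    by (intro someI[of "\<lambda>p. p \<in> C \<and> (\<forall>z\<in>C. norm (v - p) \<le> norm (v - z))" p]) auto
qed

lemma metric_proj_in:
  fixes C :: "'a::{real_inner, complete_space} set"
  assumes "C \<noteq> {}" "closed C" "convex C"
  shows "metric_proj C v \<in> C"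
  using metric_proj_nearest[OF assms] by blast

lemma metric_proj_variational:
  fixes C :: "'a::{real_inner, complete_space} set"
  assumes "C \<noteq> {}" "closed C" "convex C" "w \<in> C"
  shows "inner (metric_proj C v - v) (w - metric_proj C v) \<ge> 0"
  using any_closest_point_dot[of C "metric_proj C v" w v] metric_proj_nearest[OF assms(1-3), of v] assms
  by (auto simp: dist_norm inner_diff_left)

text \<open>Weak cluster points are replaced by points common to the closed convex hulls of all
  tails. Such points exist by the nested intersection lemma, also along subsequences, and
  convergence of the distances makes them unique.\<close>

lemma opial:
  fixes u :: "nat \<Rightarrow> 'a::{real_inner, complete_space}"
  assumes ne: "S \<noteq> {}" and conv: "\<And>z. z \<in> S \<Longrightarrow> convergent (\<lambda>n. norm (u n - z))"
    and clus: "\<And>z. (\<And>n. z \<in> closure (convex hull (u ` {n..}))) \<Longrightarrow> z \<in> S"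
  shows "\<exists>s\<in>S. weakly_converges u s"
proof -
  define K where "K r n = closure (convex hull (u ` r ` {n..}))" for r :: "nat \<Rightarrow> nat" and n
  obtain z0 where z0: "z0 \<in> S" using ne by blast
  have "Bseq (\<lambda>n. norm (u n - z0))"
    using convergent_imp_Bseq[OF conv[OF z0]] .
  then obtain B where B: "\<And>n. norm (u n - z0) \<le> B"
    by (auto simp: Bseq_def)
  have bdu: "bounded (range u)"
    using B by (auto simp: bounded_def dist_norm norm_minus_commute intro!: exI[of _ z0] exI[of _ B])
  have K_ne: "(\<Inter>n. K r n) \<noteq> {}" for r
  proof (rule nested_closed_convex_Inter_nonempty)
    show "K r m \<subseteq> K r n" if "n \<le> m" for m n
      unfolding K_def using that by (intro closure_mono hull_mono image_mono) auto
    show "bounded (K r 0)"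
      unfolding K_def
      by (intro bounded_closure bounded_convex_hull bounded_subset[OF bdu]) auto
  qed (auto simp: K_def intro: convex_closure)
  have K_sub: "(\<Inter>n. K r n) \<subseteq> (\<Inter>n. K id n)" if "strict_mono r" for r
  proof -
    have "K r n \<subseteq> K id n" for n
      unfolding K_def using that
      by (intro closure_mono hull_mono image_mono) (auto intro: order_trans[OF _ strict_mono_imp_increasing])
    then show ?thesis by blast
  qed
  have K_S: "(\<Inter>n. K id n) \<subseteq> S"
    using clus by (auto simp: K_def)
  \<comment> \<open>A closed half-space is convex, so if it contains a tail it contains the closed
    hull of that tail.\<close>
  have half: "inner z w \<ge> b" if "z \<in> (\<Inter>n. K r n)" "\<And>n. n \<ge> N \<Longrightarrow> inner (u (r n)) w \<ge> b" for r z w b N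
  proof -
    have "closure (convex hull (u ` r ` {N..})) \<subseteq> {v. inner w v \<ge> b}"
      using that(2)
      by (intro closure_minimal hull_minimal closed_halfspace_ge convex_halfspace_ge)
         (auto simp: inner_commute)
    then show ?thesis
      using that(1) by (auto simp: K_def inner_commute)
  qed
  have K_lim: "inner z w = l" if z: "z \<in> (\<Inter>n. K id n)" and lim: "(\<lambda>n. inner (u n) w) \<longlonglongrightarrow> l" for z w l
  proof (rule antisym)
    show "l \<le> inner z w"
    proof (rule field_le_epsilon)
      fix e :: real assume "0 < e"
      then obtain N where "\<And>n. n \<ge> N \<Longrightarrow> inner (u n) w \<ge> l - e"
        using order_tendstoD(1)[OF lim, of "l - e"] by (force simp: eventually_sequentially)
      then show "l \<le> inner z w + e"
        using half[where r = id and N = N and w = w and b = "l - e", OF z] by simp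
    qed
    show "inner z w \<le> l"
    proof (rule field_le_epsilon)
      fix e :: real assume "0 < e"
      then obtain N where "\<And>n. n \<ge> N \<Longrightarrow> inner (u n) w \<le> l + e"
        using order_tendstoD(2)[OF lim, of "l + e"] by (force simp: eventually_sequentially)
      then have "- (l + e) \<le> inner (u (id n)) (- w)" if "n \<ge> N" for n
        using that by fastforce
      then show "inner z w \<le> l + e"
        using half[where r = id and N = N and w = "- w" and b = "- (l + e)", OF z] by simp
    qed
  qed
  have uniq: "z = z'" if z: "z \<in> (\<Inter>n. K id n)" and z': "z' \<in> (\<Inter>n. K id n)" for z z'
  proof -
    obtain a b where ab: "(\<lambda>n. norm (u n - z)) \<longlonglongrightarrow> a" "(\<lambda>n. norm (u n - z')) \<longlonglongrightarrow> b"
      using conv[of z] conv[of z'] subsetD[OF K_S z] subsetD[OF K_S z'] unfolding convergent_def by metis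
    \<comment> \<open>The squared distances to \<open>z\<close> and \<open>z'\<close> differ by an
      affine function of \<open>u n\<close>, so \<open>inner (u n) (z - z')\<close> converges. By
      \<open>K_lim\<close> the limit is both \<open>inner z (z - z')\<close> and
      \<open>inner z' (z - z')\<close>.\<close>
    have *: "inner (u n) (z - z')
      = ((norm (u n - z'))\<^sup>2 - (norm (u n - z))\<^sup>2 + (norm z)\<^sup>2 - (norm z')\<^sup>2) / 2" for n
      by (simp add: power2_norm_eq_inner algebra_simps inner_commute)
    have lim: "(\<lambda>n. inner (u n) (z - z')) \<longlonglongrightarrow> (b\<^sup>2 - a\<^sup>2 + (norm z)\<^sup>2 - (norm z')\<^sup>2) / 2"
      unfolding * by (intro tendsto_divide tendsto_add tendsto_diff tendsto_power tendsto_const ab) simp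
    have "inner z (z - z') = inner z' (z - z')"
      using K_lim[OF z lim] K_lim[OF z' lim] by simp
    then have "inner (z - z') (z - z') = 0"
      by (simp add: inner_diff_left)
    then show ?thesis by simp
  qed
  obtain s where s: "s \<in> (\<Inter>n. K id n)"
    using K_ne[of id] by blast
  \<comment> \<open>Otherwise a subsequence stays in a closed half-space that excludes
    \<open>s\<close>, yet its tail hulls have a common point, which must be
    \<open>s\<close>.\<close>
  have ev: "eventually (\<lambda>n. inner (u n) w < inner s w + e) sequentially" if "e > 0" for w e
  proof (rule ccontr)
    assume "\<not> ?thesis"
    then have "\<exists>\<^sub>\<infinity>n. inner (u n) w \<ge> inner s w + e"
      by (simp add: not_eventually not_less cofinite_eq_sequentially)
    then obtain r :: "nat \<Rightarrow> nat" where r: "strict_mono r" "\<And>n. inner (u (r n)) w \<ge> inner s w + e"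
      using infinite_enumerate[of "{n. inner (u n) w \<ge> inner s w + e}"] by (auto simp: frequently_cofinite)
    obtain z where z: "z \<in> (\<Inter>n. K r n)" using K_ne by blast
    then have "z = s"
      using K_sub[OF r(1)] uniq[OF _ s] by blast
    then show False
      using half[where r = r and N = 0 and w = w and b = "inner s w + e", OF z] r(2) that by simp
  qed
  have "weakly_converges u s"
    unfolding weakly_converges_def
  proof (intro allI tendstoI)
    fix w and e :: real assume e: "0 < e"
    show "eventually (\<lambda>n. dist (inner (u n) w) (inner s w) < e) sequentially"
      using ev[OF e, of w] ev[OF e, of "- w"]
      by eventually_elim (auto simp: dist_real_def abs_less_iff)
  qed
  then show ?thesis using s K_S by blast
qed

text \<open>Test at points of the segment from \<open>s\<close> to \<open>w\<close>, divide by the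
  parameter and let the points tend to \<open>s\<close>.\<close>

lemma minty:
  fixes F :: "'a::real_inner \<Rightarrow> 'a"
  assumes "convex C" and s: "s \<in> C" and cont: "continuous_on UNIV F"
    and minty: "\<And>w. w \<in> C \<Longrightarrow> inner (F w) (w - s) \<ge> 0"
  shows "s \<in> VI_sol C F"
proof -
  have "inner (F s) (w - s) \<ge> 0" if w: "w \<in> C" for w
  proof -
    define h :: "nat \<Rightarrow> real" where "h n = 1 / real (Suc n)" for n
    have h: "h \<longlonglongrightarrow> 0" unfolding h_def by (rule LIMSEQ_Suc[OF lim_1_over_n])
    have pos: "inner (F (s + h n *\<^sub>R (w - s))) (w - s) \<ge> 0" for n
    proof -
      have "(1 - h n) *\<^sub>R s + h n *\<^sub>R w \<in> C"
        using assms(1) s w by (intro convexD) (auto simp: h_def)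
      then have "inner (F (s + h n *\<^sub>R (w - s))) (h n *\<^sub>R (w - s)) \<ge> 0"
        using minty[of "s + h n *\<^sub>R (w - s)"] by (simp add: algebra_simps)
      then show ?thesis
        by (simp add: h_def zero_le_mult_iff zero_le_divide_iff)
    qed
    have "isCont F s"
      using cont by (simp add: continuous_on_eq_continuous_at)
    moreover have "(\<lambda>n. s + h n *\<^sub>R (w - s)) \<longlonglongrightarrow> s + 0 *\<^sub>R (w - s)"
      by (intro tendsto_intros h)
    ultimately have "(\<lambda>n. F (s + h n *\<^sub>R (w - s))) \<longlonglongrightarrow> F s"
      by (auto intro: isCont_tendsto_compose)
    then have "(\<lambda>n. inner (F (s + h n *\<^sub>R (w - s))) (w - s)) \<longlonglongrightarrow> inner (F s) (w - s)"
      by (intro tendsto_intros)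
    then show ?thesis
      using LIMSEQ_le_const pos by blast
  qed
  then show ?thesis using s by (simp add: VI_sol_def)
qed

section \<open>The reflected gradient iteration\<close>

text \<open>Source of the constants \<open>1 + sqrt 2\<close> and \<open>sqrt 2\<close> in
  \<open>tquant\<close>. After multiplication by \<open>sqrt 2\<close>, the difference of the two
  sides is a sum of two squares with positive weights.\<close>

lemma young_three:
  fixes a b c :: real
  shows "2 * (a + b) * c \<le> (1 + sqrt 2) * a\<^sup>2 + b\<^sup>2 + sqrt 2 * c\<^sup>2"
proof -
  define q :: real where "q = sqrt 2"
  have q: "q\<^sup>2 = 2" "q > 0" by (simp_all add: q_def)
  have "0 \<le> (q * c - (a + b))\<^sup>2 + ((1 + q) * a - b)\<^sup>2 * (q - 1)"
    by (simp add: q_def)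
  also have "\<dots> = q * ((1 + q) * a\<^sup>2 + b\<^sup>2 + q * c\<^sup>2 - 2 * (a + b) * c)
      + (q\<^sup>2 - 2) * (q * a\<^sup>2 - 2 * a * b)"
    by (simp add: power2_eq_square algebra_simps)
  also have "\<dots> = q * ((1 + q) * a\<^sup>2 + b\<^sup>2 + q * c\<^sup>2 - 2 * (a + b) * c)"
    by (simp add: q(1))
  finally show ?thesis
    using q(2) by (simp add: zero_le_mult_iff q_def)
qed

text \<open>Isolates what the analysis takes from Algorithm A. \<open>lam_growth\<close> comes from
  the cap \<open>(1 + thprev) / th * lprev\<close>, \<open>accept\<close> merges the branches of
  Step 4 (in (i) the factor \<open>theta (Suc n)\<close> is 1), and \<open>lam_large\<close> stands
  in for a positive lower bound on the step sizes.\<close>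

locale reflected_gradient =
  fixes C :: "'a::{real_inner, complete_space} set"
    and F :: "'a \<Rightarrow> 'a"
    and L alpha lbar :: real
    and x y :: "nat \<Rightarrow> 'a"
    and lam theta :: "nat \<Rightarrow> real"
  assumes C: "C \<noteq> {}" "closed C" "convex C"
    and mono: "inner (F u - F v) (u - v) \<ge> 0"
    and L: "L > 0" and lip: "norm (F u - F v) \<le> L * norm (u - v)"
    and sol: "VI_sol C F \<noteq> {}"
    and alpha: "0 < alpha" "alpha < sqrt 2 - 1"
    and x0: "x 0 \<in> C"
    and x_Suc: "x (Suc n) = metric_proj C (x n - lam n *\<^sub>R F (y n))"
    and y_Suc: "y (Suc n) = x (Suc n) + theta (Suc n) *\<^sub>R (x (Suc n) - x n)"
    and theta_pos: "0 < theta n" and theta_le: "theta n \<le> 1"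
    and lam_pos: "0 < lam n" and lam_le: "lam n \<le> lbar"
    and lam_growth: "theta (Suc n) * lam (Suc n) \<le> (1 + theta n) * lam n"
    and accept: "tquant F alpha (x (Suc n)) (y n) (y (Suc n)) (lam (Suc n)) (x (Suc (Suc n))) \<le> 0
      \<or> norm (lam (Suc n) *\<^sub>R F (y (Suc n)) - (theta (Suc n) * lam n) *\<^sub>R F (y n))
          \<le> alpha * norm (y (Suc n) - y n)"
    and lam_large: "\<exists>c>0. \<exists>\<^sub>F n in sequentially. c \<le> lam n"
begin

lemma x_in: "x n \<in> C"
  using x0 metric_proj_in[OF C] by (cases n) (auto simp: x_Suc)

lemma x_Suc_variational:
  assumes "w \<in> C"
  shows "inner (x (Suc n) - x n + lam n *\<^sub>R F (y n)) (w - x (Suc n)) \<ge> 0"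
  using metric_proj_variational[OF C assms, of "x n - lam n *\<^sub>R F (y n)"]
  by (simp add: x_Suc algebra_simps)

text \<open>If the step was modified in Step 4, the variational inequality characterising \<open>x\<^sub>n\<^sub>+\<^sub>1\<close>, tested with
  \<open>x\<^sub>n\<close> and \<open>x\<^sub>n\<^sub>+\<^sub>2\<close>, bounds \<open>\<langle>F y\<^sub>n, y\<^sub>n\<^sub>+\<^sub>1 - x\<^sub>n\<^sub>+\<^sub>2\<rangle>\<close>, to which \<open>F y\<^sub>n\<^sub>+\<^sub>1\<close> is close.\<close>
lemma tquant_nonpos:
  "tquant F alpha (x (Suc n)) (y n) (y (Suc n)) (lam (Suc n)) (x (Suc (Suc n))) \<le> 0"
  using accept[of n]
proof
  define X where "X = x (Suc n)"
  define Y where "Y = y (Suc n)"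
  define Z where "Z = x (Suc (Suc n))"
  define th where "th = theta (Suc n)"
  define G where "G = lam (Suc n) *\<^sub>R F Y"
  define G' where "G' = lam n *\<^sub>R F (y n)"
  assume "norm (lam (Suc n) *\<^sub>R F (y (Suc n)) - (theta (Suc n) * lam n) *\<^sub>R F (y n))
          \<le> alpha * norm (y (Suc n) - y n)"
  then have close: "norm (G - th *\<^sub>R G') \<le> alpha * norm (Y - y n)"
    by (simp add: G_def G'_def Y_def th_def)
  have "inner (G - th *\<^sub>R G') (Y - Z) \<le> norm (G - th *\<^sub>R G') * norm (Y - Z)"
    by (rule norm_cauchy_schwarz)
  also have "\<dots> \<le> alpha * norm (Y - y n) * norm (Y - Z)"
    by (intro mult_right_mono close) simp
  \<comment> \<open>The triangle inequality through \<open>X\<close> prepares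
    \<open>young_three\<close>.\<close>
  also have "\<dots> \<le> alpha * (norm (X - Y) + norm (X - y n)) * norm (Y - Z)"
    using alpha(1) norm_triangle_sub[of "Y - y n" "X - y n"] norm_triangle_ineq4[of "X - y n" "X - Y"]
    by (intro mult_right_mono mult_left_mono) auto
  also have "\<dots> = alpha * (2 * (norm (X - Y) + norm (X - y n)) * norm (Y - Z)) / 2"
    by simp
  also have "\<dots> \<le> alpha * ((1 + sqrt 2) * (norm (X - Y))\<^sup>2 + (norm (X - y n))\<^sup>2 + sqrt 2 * (norm (Y - Z))\<^sup>2) / 2"
    using alpha(1) by (intro divide_right_mono mult_left_mono young_three) auto
  finally have first: "2 * inner (G - th *\<^sub>R G') (Y - Z) \<le> alpha *
      ((1 + sqrt 2) * (norm (X - Y))\<^sup>2 + (norm (X - y n))\<^sup>2 + sqrt 2 * (norm (Y - Z))\<^sup>2)"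
    by simp
  have YX: "Y - X = th *\<^sub>R (X - x n)"
    by (simp add: X_def Y_def th_def y_Suc)
  \<comment> \<open>The two summands correspond to the test points \<open>Z\<close> and
    \<open>x n\<close> in the variational inequality for \<open>X\<close>.\<close>
  then have Y_eq: "Y - Z = (X - Z) + th *\<^sub>R (X - x n)"
    by (simp add: algebra_simps)
  have "inner (X - x n + G') (Y - Z) = - inner (X - x n + G') (Z - X) - th * inner (X - x n + G') (x n - X)"
    by (simp add: Y_eq algebra_simps)
  also have "\<dots> \<le> 0 - th * 0"
    using x_Suc_variational[OF x_in[of "Suc (Suc n)"], of n] x_Suc_variational[OF x_in[of n], of n] theta_pos[of "Suc n"]
    unfolding X_def G'_def Z_def th_def by (intro diff_mono mult_left_mono) auto
  finally have "th * inner (X - x n + G') (Y - Z) \<le> 0"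
    using theta_pos[of "Suc n"] by (simp add: th_def mult_le_0_iff)
  then have "inner (th *\<^sub>R (X - x n)) (Y - Z) + th * inner G' (Y - Z) \<le> 0"
    by (simp add: inner_add_left distrib_left)
  then have "inner (Y - X) (Y - Z) + th * inner G' (Y - Z) \<le> 0"
    by (simp only: YX)
  moreover have "2 * inner (Y - X) (Y - Z) = (norm (X - Y))\<^sup>2 + (norm (Y - Z))\<^sup>2 - (norm (Z - X))\<^sup>2"
    by (simp add: power2_norm_eq_inner algebra_simps inner_commute)
  ultimately have "2 * th * inner G' (Y - Z) \<le> (norm (Z - X))\<^sup>2 - (norm (X - Y))\<^sup>2 - (norm (Y - Z))\<^sup>2"
    by simp
  then have "2 * inner G (Y - Z) \<le> (norm (Z - X))\<^sup>2 - (norm (X - Y))\<^sup>2 - (norm (Y - Z))\<^sup>2 + alpha *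
      ((1 + sqrt 2) * (norm (X - Y))\<^sup>2 + (norm (X - y n))\<^sup>2 + sqrt 2 * (norm (Y - Z))\<^sup>2)"
    using first by (simp add: inner_diff_left)
  then show ?thesis
    unfolding tquant_def X_def[symmetric] Y_def[symmetric] Z_def[symmetric]
    by (simp add: G_def norm_minus_commute[of Z Y] algebra_simps)
qed

section \<open>Energy descent and square-summable steps\<close>

definition kappa :: real where
  "kappa = 1 - alpha * (1 + sqrt 2)"

text \<open>This is where \<open>alpha < sqrt 2 - 1\<close> enters: \<open>sqrt 2 - 1\<close> is the
  reciprocal of \<open>1 + sqrt 2\<close>.\<close>

lemma kappa_pos: "kappa > 0"
proof -
  have "alpha * (1 + sqrt 2) < (sqrt 2 - 1) * (1 + sqrt 2)"
    using alpha by (intro mult_strict_right_mono) (auto intro: add_pos_nonneg)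
  also have "\<dots> = 1"
    by (simp add: algebra_simps)
  finally show ?thesis by (simp add: kappa_def)
qed

definition energy :: "'a \<Rightarrow> nat \<Rightarrow> real" where
  "energy z n = (norm (x (Suc n) - z))\<^sup>2 + 2 * (1 + theta n) * lam n * inner (F z) (x n - z)
     + alpha * (norm (x (Suc n) - y n))\<^sup>2"

lemma VI_sol_nonneg: "z \<in> VI_sol C F \<Longrightarrow> inner (F z) (x n - z) \<ge> 0"
  using x_in by (auto simp: VI_sol_def)

lemma energy_nonneg: "z \<in> VI_sol C F \<Longrightarrow> 0 \<le> energy z n"
  unfolding energy_def using VI_sol_nonneg theta_pos[of n] lam_pos[of n] alpha(1)
  by (intro add_nonneg_nonneg mult_nonneg_nonneg) auto

text \<open>Combines the projection inequality tested at \<open>z\<close>, monotonicity between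
  \<open>y (Suc n)\<close> and \<open>z\<close>, and \<open>tquant_nonpos\<close>. The last term of
  \<open>energy z n\<close> pays for the term of \<open>tquant\<close> that contains
  \<open>yprev\<close>.\<close>

lemma energy_descent:
  assumes z: "z \<in> VI_sol C F"
  shows "energy z (Suc n) + kappa * ((norm (x (Suc n) - y (Suc n)))\<^sup>2 + (norm (x (Suc (Suc n)) - y (Suc n)))\<^sup>2)
    \<le> energy z n"
proof -
  define X where "X = x (Suc n)"
  define Y where "Y = y (Suc n)"
  define Z where "Z = x (Suc (Suc n))"
  define th where "th = theta (Suc n)"
  define l where "l = lam (Suc n)"
  define a where "a n = inner (F z) (x n - z)" for n
  have "inner (Z - X + l *\<^sub>R F Y) (z - Z) \<ge> 0"
    using x_Suc_variational[of z "Suc n"] z by (simp add: X_def Y_def Z_def l_def VI_sol_def)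
  then have "2 * inner (Z - X) (Z - z) \<le> 2 * l * inner (F Y) (z - Z)"
    by (simp add: algebra_simps)
  moreover have "2 * inner (Z - X) (Z - z) = (norm (Z - z))\<^sup>2 + (norm (Z - X))\<^sup>2 - (norm (X - z))\<^sup>2"
    by (simp add: power2_norm_eq_inner algebra_simps inner_commute)
  moreover have "l * inner (F Y - F z) (Y - z) \<ge> 0"
    using mono[of Y z] lam_pos[of "Suc n"] by (simp add: l_def)
  then have "2 * l * inner (F Y) (z - Z) \<le> 2 * l * inner (F Y) (Y - Z) - 2 * l * inner (F z) (Y - z)"
    by (simp add: algebra_simps)
  \<comment> \<open>The reflection leaves a multiple of \<open>a n\<close>, the value at the
    preceding iterate; \<open>lam_growth\<close> bounds it by the middle term of
    \<open>energy z n\<close>.\<close>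
  moreover have "inner (F z) (Y - z) = (1 + th) * a (Suc n) - th * a n"
    by (simp add: Y_def y_Suc a_def th_def algebra_simps)
  then have "2 * l * inner (F z) (Y - z) = 2 * (1 + th) * l * a (Suc n) - 2 * (th * l) * a n"
    by (simp only:) (simp add: algebra_simps)
  moreover have "2 * (th * l) * a n \<le> 2 * ((1 + theta n) * lam n) * a n"
    using lam_growth[of n] VI_sol_nonneg[OF z, of n] unfolding a_def th_def l_def
    by (intro mult_right_mono mult_left_mono) auto
  \<comment> \<open>\<open>kappa + alpha\<close> equals \<open>1 - sqrt 2 * alpha\<close>: the part
    \<open>alpha\<close> goes into the energy at \<open>Suc n\<close>, the part \<open>kappa\<close>
    remains as gain.\<close>
  moreover have "- (norm (Z - X))\<^sup>2 + 2 * l * inner (F Y) (Y - Z) + kappa * (norm (X - Y))\<^sup>2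
      - alpha * (norm (X - y n))\<^sup>2 + (kappa + alpha) * (norm (Z - Y))\<^sup>2 \<le> 0"
    using tquant_nonpos[of n] by (simp add: tquant_def kappa_def X_def Y_def Z_def l_def algebra_simps)
  ultimately show ?thesis
    unfolding energy_def a_def[symmetric]
    unfolding X_def[symmetric] Y_def[symmetric] Z_def[symmetric] th_def[symmetric] l_def[symmetric]
    by (simp only: distrib_left distrib_right mult.assoc)
qed

lemma energy_convergent:
  assumes "z \<in> VI_sol C F"
  shows "convergent (energy z)"
proof -
  have "decseq (energy z)"
  proof (rule decseq_SucI)
    fix n
    have "0 \<le> kappa * ((norm (x (Suc n) - y (Suc n)))\<^sup>2 + (norm (x (Suc (Suc n)) - y (Suc n)))\<^sup>2)"
      using kappa_pos by simp
    then show "energy z (Suc n) \<le> energy z n"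
      using energy_descent[OF assms, of n] by linarith
  qed
  then show ?thesis
    using decseq_convergent[of "energy z" 0] energy_nonneg[OF assms] unfolding convergent_def by metis
qed

lemma steps_summable:
  "summable (\<lambda>n. (norm (x (Suc n) - y (Suc n)))\<^sup>2 + (norm (x (Suc (Suc n)) - y (Suc n)))\<^sup>2)"
proof -
  obtain z where z: "z \<in> VI_sol C F" using sol by blast
  obtain e where "energy z \<longlonglongrightarrow> e"
    using energy_convergent[OF z] unfolding convergent_def by blast
  then have "summable (\<lambda>n. energy z n - energy z (Suc n))"
    using telescope_sums' sums_summable by blast
  then have "summable (\<lambda>n. (energy z n - energy z (Suc n)) / kappa)"
    by (rule summable_divide)
  then show ?thesis
  proof (rule summable_comparison_test')
    fix n
    show "norm ((norm (x (Suc n) - y (Suc n)))\<^sup>2 + (norm (x (Suc (Suc n)) - y (Suc n)))\<^sup>2)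
      \<le> (energy z n - energy z (Suc n)) / kappa"
      using energy_descent[OF z, of n] kappa_pos by (simp add: pos_le_divide_eq mult.commute)
  qed
qed

lemma next_step_summable: "summable (\<lambda>n. (norm (x (Suc n) - y n))\<^sup>2)"
  using summable_comparison_test'[OF steps_summable, of 0 "\<lambda>n. (norm (x (Suc (Suc n)) - y (Suc n)))\<^sup>2"]
  by (subst summable_Suc_iff[symmetric]) simp

lemma next_step_tendsto: "(\<lambda>n. norm (x (Suc n) - y n)) \<longlonglongrightarrow> 0"
  using tendsto_real_sqrt[OF summable_LIMSEQ_zero[OF next_step_summable]] by simp

lemma reflection_tendsto: "(\<lambda>n. norm (x n - y n)) \<longlonglongrightarrow> 0"
proof -
  have "summable (\<lambda>n. (norm (x (Suc n) - y (Suc n)))\<^sup>2)"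
    using summable_comparison_test'[OF steps_summable, of 0 "\<lambda>n. (norm (x (Suc n) - y (Suc n)))\<^sup>2"] by simp
  then have "(\<lambda>n. norm (x (Suc n) - y (Suc n))) \<longlonglongrightarrow> 0"
    using tendsto_real_sqrt[OF summable_LIMSEQ_zero] by force
  then show ?thesis by (rule LIMSEQ_imp_Suc)
qed

lemma step_tendsto: "(\<lambda>n. norm (x (Suc n) - x n)) \<longlonglongrightarrow> 0"
proof (rule Lim_null_comparison)
  show "(\<lambda>n. norm (x (Suc n) - y n) + norm (x n - y n)) \<longlonglongrightarrow> 0"
    using tendsto_add[OF next_step_tendsto reflection_tendsto] by simp
  show "eventually (\<lambda>n. norm (norm (x (Suc n) - x n)) \<le> norm (x (Suc n) - y n) + norm (x n - y n)) sequentially"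
  proof (intro always_eventually allI)
    fix n
    show "norm (norm (x (Suc n) - x n)) \<le> norm (x (Suc n) - y n) + norm (x n - y n)"
      using norm_triangle_ineq4[of "x (Suc n) - y n" "x n - y n"] by simp
  qed
qed

section \<open>Boundedness and convergence of the distances to solutions\<close>

lemma x_bounded: obtains B where "\<And>n. norm (x n - z) \<le> B"
proof -
  obtain s where s: "s \<in> VI_sol C F" using sol by blast
  obtain M where M: "\<And>n. energy s n \<le> M"
    using convergent_imp_Bseq[OF energy_convergent[OF s]] by (auto simp: Bseq_def abs_le_iff)
  have "(norm (x (Suc n) - s))\<^sup>2 \<le> M" for n
  proof -
    have "0 \<le> 2 * (1 + theta n) * lam n * inner (F s) (x n - s)" "0 \<le> alpha * (norm (x (Suc n) - y n))\<^sup>2"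
      using VI_sol_nonneg[OF s] theta_pos[of n] lam_pos[of n] alpha(1)
      by (auto intro!: mult_nonneg_nonneg)
    then show ?thesis using M[of n] by (simp add: energy_def)
  qed
  then have *: "norm (x (Suc n) - s) \<le> sqrt M" for n
    by (simp add: real_le_rsqrt)
  \<comment> \<open>The energy controls \<open>x (Suc n)\<close> only, hence the maximum with the
    initial distance.\<close>
  have "norm (x n - z) \<le> max (norm (x 0 - s)) (sqrt M) + norm (s - z)" for n
    using * [of "n - 1"] norm_triangle_ineq[of "x n - s" "s - z"] by (cases n) auto
  then show ?thesis by (rule that)
qed

text \<open>Lets convergence of the energy pass to the distances. Monotonicity replaces
  \<open>F z\<close> by \<open>F (y n)\<close> up to vanishing errors, and the projection inequality
  bounds \<open>lam n * inner (F (y n)) (x (Suc n) - z)\<close> by a multiple of the step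
  length.\<close>

lemma energy_cross_tendsto:
  assumes z: "z \<in> VI_sol C F"
  shows "(\<lambda>n. 2 * (1 + theta n) * lam n * inner (F z) (x n - z)) \<longlonglongrightarrow> 0"
proof -
  have zC: "z \<in> C" using z by (simp add: VI_sol_def)
  obtain B where B: "\<And>n. norm (x n - z) \<le> B" using x_bounded by blast
  have B0: "0 \<le> B" using B[of 0] norm_ge_zero order_trans by blast
  have lbar: "0 \<le> lbar" using lam_pos[of 0] lam_le[of 0] by simp
  define b where "b n = norm (x (Suc n) - x n) * B
    + lbar * ((norm (F z) + L * (norm (x n - y n) + B)) * norm (x (Suc n) - y n) + norm (F z) * norm (x n - y n))" for n
  have "b \<longlonglongrightarrow> 0 * B + lbar * ((norm (F z) + L * (0 + B)) * 0 + norm (F z) * 0)"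
    unfolding b_def by (intro tendsto_intros step_tendsto next_step_tendsto reflection_tendsto)
  \<comment> \<open>The factor 4 bounds \<open>2 * (1 + theta n)\<close>.\<close>
  then have b: "(\<lambda>n. 4 * b n) \<longlonglongrightarrow> 0"
    by (auto intro: tendsto_mult_right_zero)
  have key: "lam n * inner (F z) (x n - z) \<le> b n" for n
  proof -
    have l: "0 \<le> lam n" using lam_pos[of n] by simp
    have "inner (F (y n) - F z) (y n - z) \<ge> 0" by (rule mono)
    then have "inner (F z) (x n - z) \<le> inner (F (y n)) (x (Suc n) - z)
        + inner (F (y n)) (y n - x (Suc n)) + inner (F z) (x n - y n)"
      by (simp add: algebra_simps)
    also have "\<dots> \<le> inner (F (y n)) (x (Suc n) - z)
        + norm (F (y n)) * norm (x (Suc n) - y n) + norm (F z) * norm (x n - y n)"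
      using norm_cauchy_schwarz[of "F (y n)" "y n - x (Suc n)"] norm_cauchy_schwarz[of "F z" "x n - y n"]
      by (simp add: norm_minus_commute)
    also have "norm (F (y n)) \<le> norm (F z) + L * (norm (x n - y n) + B)"
    proof -
      have "norm (F (y n)) \<le> norm (F z) + L * norm (y n - z)"
        using norm_triangle_sub[of "F (y n)" "F z"] lip[of "y n" z] by simp
      moreover have "norm (y n - z) \<le> norm (x n - y n) + B"
        using norm_triangle_ineq4[of "x n - z" "x n - y n"] B[of n] by simp
      ultimately show ?thesis
        using L by (smt (verit) mult_left_mono)
    qed
    finally have "inner (F z) (x n - z) \<le> inner (F (y n)) (x (Suc n) - z)
        + ((norm (F z) + L * (norm (x n - y n) + B)) * norm (x (Suc n) - y n) + norm (F z) * norm (x n - y n))" (is "_ \<le> _ + ?r")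
      by (simp add: mult_right_mono)
    then have "lam n * inner (F z) (x n - z) \<le> lam n * inner (F (y n)) (x (Suc n) - z) + lam n * ?r"
      using l by (metis mult_left_mono distrib_left)
    also have "lam n * ?r \<le> lbar * ?r"
      using lam_le[of n] L B0 by (intro mult_right_mono) auto
    also have "lam n * inner (F (y n)) (x (Suc n) - z) \<le> inner (x (Suc n) - x n) (z - x (Suc n))"
      using x_Suc_variational[OF zC, of n] by (simp add: algebra_simps)
    also have "\<dots> \<le> norm (x (Suc n) - x n) * norm (x (Suc n) - z)"
      using norm_cauchy_schwarz[of "x (Suc n) - x n" "z - x (Suc n)"] by (simp add: norm_minus_commute)
    also have "\<dots> \<le> norm (x (Suc n) - x n) * B"
      by (intro mult_left_mono B) simp
    finally show ?thesis by (simp add: b_def)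
  qed
  show ?thesis
  proof (rule Lim_null_comparison[OF _ b], rule always_eventually, rule allI)
    fix n
    have a: "0 \<le> lam n * inner (F z) (x n - z)"
      using lam_pos[of n] VI_sol_nonneg[OF z, of n] by simp
    have "2 * (1 + theta n) * (lam n * inner (F z) (x n - z)) \<le> 4 * (lam n * inner (F z) (x n - z))"
      using theta_le[of n] by (intro mult_right_mono a) simp
    moreover have "0 \<le> 2 * (1 + theta n) * (lam n * inner (F z) (x n - z))"
      using theta_pos[of n] by (intro mult_nonneg_nonneg[OF _ a]) simp
    ultimately show "norm (2 * (1 + theta n) * lam n * inner (F z) (x n - z)) \<le> 4 * b n"
      using key[of n] by (simp add: mult.assoc)
  qed
qed

lemma dist_solution_convergent:
  assumes z: "z \<in> VI_sol C F"
  shows "convergent (\<lambda>n. norm (x n - z))"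
proof -
  obtain e where e: "energy z \<longlonglongrightarrow> e"
    using energy_convergent[OF z] unfolding convergent_def by blast
  have "(\<lambda>n. energy z n - 2 * (1 + theta n) * lam n * inner (F z) (x n - z) - alpha * (norm (x (Suc n) - y n))\<^sup>2)
     \<longlonglongrightarrow> e - 0 - alpha * 0\<^sup>2"
    by (intro tendsto_intros e energy_cross_tendsto[OF z] next_step_tendsto)
  then have "(\<lambda>n. (norm (x (Suc n) - z))\<^sup>2) \<longlonglongrightarrow> e"
    by (simp add: energy_def)
  then have "(\<lambda>n. norm (x (Suc n) - z)) \<longlonglongrightarrow> sqrt e"
    using tendsto_real_sqrt by force
  then show ?thesis
    using LIMSEQ_imp_Suc[of "\<lambda>n. norm (x n - z)"] unfolding convergent_def by blast
qed

section \<open>Decay of the residual\<close>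

definition residual :: "nat \<Rightarrow> 'a" where
  "residual n = (x n - x (Suc n)) /\<^sub>R lam n - F (y n) + F (x (Suc n))"

lemma residual_normal:
  assumes "w \<in> C"
  shows "inner (residual n - F (x (Suc n))) (w - x (Suc n)) \<le> 0"
proof -
  have "residual n - F (x (Suc n)) = - (x (Suc n) - x n + lam n *\<^sub>R F (y n)) /\<^sub>R lam n"
    using lam_pos[of n] by (simp add: residual_def algebra_simps)
  then show ?thesis
    using x_Suc_variational[OF assms, of n] lam_pos[of n]
    by (simp only: inner_scaleR_left inner_minus_left) (simp add: mult_nonneg_nonneg)
qed

text \<open>Monotonicity of F plus the normal cone pairs \<open>g' - g\<close> with
  \<open>Z - X\<close>, which is a negative multiple of \<open>g' - D\<close>. The step size is only
  the factor of this multiple and divides out. Expanding the square of \<open>g' - g - D\<close>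
  finishes.\<close>

lemma residual_decay:
  "(norm (residual (Suc n)))\<^sup>2 \<le> (norm (residual n))\<^sup>2 + L\<^sup>2 * (norm (x (Suc (Suc n)) - y (Suc n)))\<^sup>2"
proof -
  define g where "g = residual n"
  define g' where "g' = residual (Suc n)"
  define X where "X = x (Suc n)"
  define Z where "Z = x (Suc (Suc n))"
  define D where "D = F Z - F (y (Suc n))"
  have l: "lam (Suc n) > 0" by (rule lam_pos)
  have "inner (g' - g) (Z - X) \<ge> 0"
    using residual_normal[OF x_in[of "Suc (Suc n)"], of n] residual_normal[OF x_in[of "Suc n"], of "Suc n"]
      mono[of Z X]
    by (simp add: g_def g'_def X_def Z_def algebra_simps)
  moreover have "Z - X = - lam (Suc n) *\<^sub>R (g' - D)"
    using l by (simp add: g'_def residual_def D_def X_def Z_def)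
  ultimately have "inner (g' - g) (g' - D) \<le> 0"
    using l by (simp add: mult_le_0_iff)
  moreover have "0 \<le> inner (g' - g - D) (g' - g - D)"
    by simp
  ultimately have "inner g' g' \<le> inner g g + inner D D"
    by (simp add: algebra_simps inner_commute)
  moreover have "(norm D)\<^sup>2 \<le> (L * norm (Z - y (Suc n)))\<^sup>2"
    unfolding D_def by (intro power_mono lip) simp
  ultimately show ?thesis
    by (simp add: power2_norm_eq_inner[symmetric] power_mult_distrib g_def g'_def Z_def)
qed

text \<open>At an index with \<open>c \<le> lam n\<close> the residual is bounded by
  \<open>r n\<close>, which tends to 0. From there \<open>residual_decay\<close> with summable
  errors keeps all later residuals small.\<close>

lemma residual_tendsto: "(\<lambda>n. norm (residual n)) \<longlonglongrightarrow> 0"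
proof -
  obtain c where c: "c > 0" and freq: "\<exists>\<^sub>F n in sequentially. c \<le> lam n"
    using lam_large by blast
  define s where "s n = L\<^sup>2 * (norm (x (Suc (Suc n)) - y (Suc n)))\<^sup>2" for n
  have "summable (\<lambda>n. L\<^sup>2 * (norm (x (Suc n) - y n))\<^sup>2)"
    by (intro summable_mult next_step_summable)
  then have s: "summable s"
    using summable_Suc_iff[of "\<lambda>n. L\<^sup>2 * (norm (x (Suc n) - y n))\<^sup>2"] by (simp add: s_def[abs_def])
  have s0: "0 \<le> s n" for n by (simp add: s_def)
  have sum_le: "(norm (residual (n + k)))\<^sup>2 \<le> (norm (residual n))\<^sup>2 + (\<Sum>i<k. s (n + i))" for n k
  proof (induction k)
    case (Suc k)
    then show ?case using residual_decay[of "n + k"] by (simp add: s_def)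
  qed simp
  have tail: "(\<lambda>n. \<Sum>i. s (i + n)) \<longlonglongrightarrow> 0"
    using suminf_exist_split2[OF s] .
  have sum_tail: "(\<Sum>i<k. s (n + i)) \<le> (\<Sum>i. s (i + n))" for n k
    using sum_le_suminf[OF summable_ignore_initial_segment[OF s, of n], of "{..<k}"] s0
    by (simp add: add.commute)
  define r where "r n = norm (x (Suc n) - x n) / c + L * norm (x (Suc n) - y n)" for n
  have "r \<longlonglongrightarrow> 0 / c + L * 0"
    unfolding r_def using c by (intro tendsto_intros step_tendsto next_step_tendsto) auto
  then have r: "(\<lambda>n. (r n)\<^sup>2 + (\<Sum>i. s (i + n))) \<longlonglongrightarrow> 0"
    using tendsto_add[OF tendsto_power[of r 0 _ 2] tail] by simp
  have res_r: "norm (residual n) \<le> r n" if "c \<le> lam n" for n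
  proof -
    have "norm (residual n) \<le> norm ((x n - x (Suc n)) /\<^sub>R lam n) + norm (F (x (Suc n)) - F (y n))"
      using norm_triangle_ineq[of "(x n - x (Suc n)) /\<^sub>R lam n" "F (x (Suc n)) - F (y n)"]
      by (simp add: residual_def algebra_simps)
    also have "norm ((x n - x (Suc n)) /\<^sub>R lam n) = norm (x (Suc n) - x n) / lam n"
      using lam_pos[of n] by (simp add: norm_minus_commute divide_inverse mult.commute)
    also have "\<dots> \<le> norm (x (Suc n) - x n) / c"
      using c that by (intro divide_left_mono) auto
    finally show ?thesis
      using lip[of "x (Suc n)" "y n"] by (simp add: r_def)
  qed
  have "(\<lambda>n. (norm (residual n))\<^sup>2) \<longlonglongrightarrow> 0"
  proof (rule order_tendstoI)
    fix e :: real assume "0 < e"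
    then have "eventually (\<lambda>n. (r n)\<^sup>2 + (\<Sum>i. s (i + n)) < e) sequentially"
      by (rule order_tendstoD(2)[OF r])
    \<comment> \<open>An event that occurs infinitely often meets one that holds eventually.\<close>
    then obtain N where N: "c \<le> lam N" "(r N)\<^sup>2 + (\<Sum>i. s (i + N)) < e"
      using frequently_ex[OF frequently_eventually_conj[OF freq]] by blast
    have "(norm (residual n))\<^sup>2 < e" if "n \<ge> N" for n
    proof -
      have "(norm (residual N))\<^sup>2 \<le> (r N)\<^sup>2"
        by (intro power_mono res_r N) simp
      then show ?thesis
        using sum_le[of N "n - N"] sum_tail[where n = N and k = "n - N"] N(2) that by simp
    qed
    then show "eventually (\<lambda>n. (norm (residual n))\<^sup>2 < e) sequentially"
      by (auto simp: eventually_sequentially)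
  next
    fix e :: real assume "e < 0"
    then show "eventually (\<lambda>n. e < (norm (residual n))\<^sup>2) sequentially"
      by (intro always_eventually allI) (auto intro: less_le_trans)
  qed
  then show ?thesis
    using tendsto_real_sqrt by force
qed

section \<open>Cluster points are solutions; weak convergence\<close>

lemma cluster_in_VI_sol:
  assumes z: "\<And>n. z \<in> closure (convex hull (x ` {n..}))"
  shows "z \<in> VI_sol C F"
proof (rule minty[OF C(3)])
  have "closure (convex hull (x ` {0..})) \<subseteq> C"
    using x_in C by (intro closure_minimal hull_minimal) auto
  then show "z \<in> C" using z by blast
  have "L-lipschitz_on UNIV F"
    using lip L by (auto simp: lipschitz_on_def dist_norm)
  then show "continuous_on UNIV F"
    by (rule lipschitz_on_continuous_on)
  fix w assume w: "w \<in> C"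
  obtain B where B: "\<And>n. norm (x n - w) \<le> B" using x_bounded by blast
  have b: "(\<lambda>n. norm (residual n) * B) \<longlonglongrightarrow> 0"
    by (intro tendsto_mult_left_zero residual_tendsto)
  have le: "inner (F w) (x (Suc n)) \<le> inner (F w) w + norm (residual n) * B" for n
  proof -
    have "inner (F w) (x (Suc n) - w) \<le> inner (residual n) (x (Suc n) - w)"
      using residual_normal[OF w, of n] mono[of w "x (Suc n)"] by (simp add: algebra_simps)
    also have "\<dots> \<le> norm (residual n) * norm (x (Suc n) - w)"
      by (rule norm_cauchy_schwarz)
    also have "\<dots> \<le> norm (residual n) * B"
      by (intro mult_left_mono B) simp
    finally show ?thesis by (simp add: inner_diff_right)
  qed
  have "inner (F w) z \<le> inner (F w) w"
  proof (rule field_le_epsilon)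
    fix e :: real assume "0 < e"
    then obtain N where N: "\<And>n. n \<ge> N \<Longrightarrow> norm (residual n) * B < e"
      using order_tendstoD(2)[OF b, of e] by (auto simp: eventually_sequentially)
    have "inner (F w) (x n) \<le> inner (F w) w + e" if "n \<ge> Suc N" for n
      using le[of "n - 1"] N[of "n - 1"] that by (cases n) auto
    \<comment> \<open>The inequality in Minty's form is linear in the point, so it passes from a
      tail to its closed convex hull.\<close>
    then have "closure (convex hull (x ` {Suc N..})) \<subseteq> {v. inner (F w) v \<le> inner (F w) w + e}"
      by (intro closure_minimal hull_minimal closed_halfspace_le convex_halfspace_le) auto
    then show "inner (F w) z \<le> inner (F w) w + e"
      using z by blast
  qed
  then show "inner (F w) (w - z) \<ge> 0"
    by (simp add: inner_diff_right)
qed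

theorem weak_convergence:
  "\<exists>s\<in>VI_sol C F. weakly_converges x s \<and> weakly_converges y s"
proof -
  obtain s where s: "s \<in> VI_sol C F" "weakly_converges x s"
    using opial[OF sol dist_solution_convergent cluster_in_VI_sol] by blast
  have "(\<lambda>n. inner (y n) w) \<longlonglongrightarrow> inner s w" for w
  proof -
    have "(\<lambda>n. x n - y n) \<longlonglongrightarrow> 0"
      using reflection_tendsto by (simp add: tendsto_norm_zero_iff)
    then have "(\<lambda>n. inner (x n) w - inner (x n - y n) w) \<longlonglongrightarrow> inner s w - inner 0 w"
      using s(2) unfolding weakly_converges_def
      by (intro tendsto_diff[OF _ tendsto_inner[OF _ tendsto_const]]) auto
    then show ?thesis by (simp add: inner_diff_left)
  qed
  then show ?thesis
    using s unfolding weakly_converges_def by blast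
qed

end

section \<open>Algorithm A\<close>

lemma capped_ratio_le: "capped_ratio a b c \<le> c"
  by (simp add: capped_ratio_def)

text \<open>The Lipschitz bound keeps the ratio at or above \<open>alpha / L\<close>; for
  \<open>b = 0\<close> the convention returns \<open>c\<close>.\<close>

lemma capped_ratio_lipschitz_ge:
  assumes "b \<le> L * r" "0 \<le> b" "0 < L" "0 < alpha"
  shows "min (alpha / L) c \<le> capped_ratio (alpha * r) b c"
proof (cases "b = 0")
  case False
  then have "alpha / L \<le> alpha * r / b"
    using assms by (simp add: field_simps)
  then show ?thesis by (auto simp: capped_ratio_def)
qed (simp add: capped_ratio_def)

text \<open>The last conclusion replaces a lower bound on the step size: outside Step 4 (ii) the
  first disjunct holds, and (ii) is entered only if the trial step is below \<open>lprev\<close>,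
  which forces the second.\<close>

lemma algA_step_properties:
  fixes F :: "'a::real_inner \<Rightarrow> 'a"
  assumes step: "algA_step C F alpha lbar xprev xn yprev lprev thprev yn l th xnext"
    and lip: "\<And>u v. norm (F u - F v) \<le> L * norm (u - v)" and L: "L > 0"
    and alpha: "alpha > 0" and lbar: "0 < lbar"
    and lprev: "0 < lprev" "lprev \<le> lbar" and thprev: "0 < thprev"
  shows "xnext = metric_proj C (xn - l *\<^sub>R F yn)"
    and "yn = xn + th *\<^sub>R (xn - xprev)"
    and "0 < th" and "th \<le> 1" and "0 < l" and "l \<le> lbar"
    and "th * l \<le> (1 + thprev) * lprev"
    and "tquant F alpha xn yprev yn l xnext \<le> 0
      \<or> norm (l *\<^sub>R F yn - (th * lprev) *\<^sub>R F yprev) \<le> alpha * norm (yn - yprev)"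
    and "min lprev (alpha / L) \<le> l \<or> alpha / L \<le> lprev"
proof -
  define lamf where "lamf = stepfun F alpha lbar yprev lprev thprev"
  define y' where "y' = 2 *\<^sub>R xn - xprev"
  have y': "y' = xn + 1 *\<^sub>R (xn - xprev)"
    by (simp add: y'_def scaleR_2)
  have grow: "lprev \<le> (1 + thprev) / 1 * lprev"
    using lprev thprev by (simp add: algebra_simps)
  have lamf_le: "lamf v h \<le> lbar" "lamf v h \<le> (1 + thprev) / h * lprev" for v h
    using capped_ratio_le[of _ _ "min ((1 + thprev) / h * lprev) lbar"]
    unfolding lamf_def stepfun_def by (auto intro: order_trans)
  have lamf_ge: "min (alpha / L) (min ((1 + thprev) / h * lprev) lbar) \<le> lamf v h" for v h
    unfolding lamf_def stepfun_def
    by (intro capped_ratio_lipschitz_ge lip L alpha) simp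
  \<comment> \<open>Both caps, \<open>(1 + thprev) * lprev\<close> and \<open>lbar\<close>, are at
    least \<open>lprev\<close>.\<close>
  have ge: "min lprev (alpha / L) \<le> lamf y' 1"
    using lamf_ge[of 1 y'] grow lprev(2) by linarith
  have pos: "0 < lamf y' 1"
    using ge lprev(1) alpha L by (smt (verit) divide_pos_pos)
  consider
      (accept) "tquant F alpha xn yprev yn l xnext \<le> 0" "yn = y'" "l = lamf y' 1" "th = 1"
        "xnext = metric_proj C (xn - l *\<^sub>R F yn)"
    | (enlarge) "yn = y'" "th = 1" "lprev \<le> l" "l \<le> lamf y' 1"
        "norm (l *\<^sub>R F yn - (th * lprev) *\<^sub>R F yprev) \<le> alpha * norm (yn - yprev)"
        "xnext = metric_proj C (xn - l *\<^sub>R F yn)"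
    | (shrink) "lamf y' 1 < lprev" "0 < th" "th \<le> 1" "yn = xn + th *\<^sub>R (xn - xprev)"
        "th * lprev \<le> l" "l \<le> lamf yn th"
        "norm (l *\<^sub>R F yn - (th * lprev) *\<^sub>R F yprev) \<le> alpha * norm (yn - yprev)"
        "xnext = metric_proj C (xn - l *\<^sub>R F yn)"
    using step unfolding algA_step_def Let_def lamf_def[symmetric] y'_def[symmetric]
    by (elim conjE disjE) auto
  then have "xnext = metric_proj C (xn - l *\<^sub>R F yn)
    \<and> yn = xn + th *\<^sub>R (xn - xprev) \<and> 0 < th \<and> th \<le> 1 \<and> 0 < l \<and> l \<le> lamf yn th
    \<and> (tquant F alpha xn yprev yn l xnext \<le> 0
      \<or> norm (l *\<^sub>R F yn - (th * lprev) *\<^sub>R F yprev) \<le> alpha * norm (yn - yprev))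
    \<and> (min lprev (alpha / L) \<le> l \<or> alpha / L \<le> lprev)"
  proof cases
    case accept
    then show ?thesis using ge pos y' by simp
  next
    case enlarge
    then show ?thesis using lprev y' by (simp add: min.coboundedI1)
  next
    case shrink
    have "0 < l" using shrink(2,5) lprev(1) by (meson less_le_trans mult_pos_pos)
    moreover have "alpha / L \<le> lprev" using ge shrink(1) by linarith
    ultimately show ?thesis using shrink by simp
  qed
  moreover from this have "l \<le> lbar" "th * l \<le> (1 + thprev) * lprev"
    using order_trans[OF _ lamf_le(1), of l yn th] order_trans[OF _ lamf_le(2), of l yn th]
    by (auto simp: pos_le_divide_eq mult.commute)
  ultimately show "xnext = metric_proj C (xn - l *\<^sub>R F yn)"
    and "yn = xn + th *\<^sub>R (xn - xprev)"
    and "0 < th" and "th \<le> 1" and "0 < l" and "l \<le> lbar"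
    and "th * l \<le> (1 + thprev) * lprev"
    and "tquant F alpha xn yprev yn l xnext \<le> 0
      \<or> norm (l *\<^sub>R F yn - (th * lprev) *\<^sub>R F yprev) \<le> alpha * norm (yn - yprev)"
    and "min lprev (alpha / L) \<le> l \<or> alpha / L \<le> lprev"
    by blast+
qed

text \<open>Either \<open>l\<close> reaches \<open>a\<close> infinitely often, or it is eventually
  below \<open>a\<close>; then the minimum in \<open>step\<close> must be \<open>l n\<close>, so
  \<open>l\<close> is nondecreasing from some \<open>N\<close> on and \<open>l N\<close> serves as
  \<open>c\<close>.\<close>

lemma frequently_ge_if_weakly_bounded_decrease:
  fixes l :: "nat \<Rightarrow> real"
  assumes pos: "\<And>n. 0 < l n" and "0 < a" and step: "\<And>n. min (l n) a \<le> l (Suc n) \<or> a \<le> l n"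
  shows "\<exists>c>0. \<exists>\<^sub>F n in sequentially. c \<le> l n"
proof (cases "\<exists>\<^sub>F n in sequentially. a \<le> l n")
  case True
  then show ?thesis using \<open>0 < a\<close> by blast
next
  case False
  then obtain N where N: "\<And>n. n \<ge> N \<Longrightarrow> \<not> a \<le> l n"
    by (auto simp: not_frequently eventually_sequentially)
  have "l N \<le> l (N + k)" for k
  proof (induction k)
    case (Suc k)
    then show ?case using step[of "N + k"] N[of "N + k"] N[of "Suc (N + k)"] by auto
  qed simp
  then have "eventually (\<lambda>n. l N \<le> l n) sequentially"
    unfolding eventually_sequentially by (metis le_Suc_ex)
  then show ?thesis
    using pos[of N] eventually_frequently[of sequentially] by auto
qed

theorem theorem4p6:
  fixes C :: "'a::{real_inner, complete_space} set"
    and F :: "'a \<Rightarrow> 'a"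
    and L alpha lbar lm1 :: real
    and x y :: "nat \<Rightarrow> 'a"
    and lam theta :: "nat \<Rightarrow> real"
  assumes "C \<noteq> {}" and "closed C" and "convex C"
    and "\<forall>u v. inner (F u - F v) (u - v) \<ge> 0"
    and "L > 0" and "\<forall>u v. norm (F u - F v) \<le> L * norm (u - v)"
    and "VI_sol C F \<noteq> {}"
    and "algA_run C F alpha lbar lm1 x y lam theta"
  shows "\<exists>s\<in>VI_sol C F. weakly_converges x s \<and> weakly_converges y s"
proof -
  have run: "0 < alpha" "alpha < sqrt 2 - 1" "0 < lbar" "x 0 \<in> C" "theta 0 = 1"
    "lam 0 = capped_ratio (alpha * norm (x 0 - y 0)) (norm (F (x 0) - F (y 0))) lbar"
    "x 1 = metric_proj C (x 0 - lam 0 *\<^sub>R F (y 0))"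
    and steps: "\<And>n. algA_step C F alpha lbar (x n) (x (Suc n)) (y n) (lam n) (theta n)
                (y (Suc n)) (lam (Suc n)) (theta (Suc n)) (x (Suc (Suc n)))"
    using assms(8) unfolding algA_run_def
    by (auto dest: spec[of _ "Suc _"])
  have lip: "norm (F u - F v) \<le> L * norm (u - v)" for u v
    using assms(6) by blast
  note step = algA_step_properties[OF steps lip assms(5) run(1,3)]
  have "min (alpha / L) lbar \<le> lam 0"
    unfolding run(6) by (intro capped_ratio_lipschitz_ge lip assms(5) run(1)) simp
  then have lam0: "0 < lam 0"
    using run(1,3) assms(5) by (smt (verit) divide_pos_pos)
  have inv: "0 < lam n \<and> lam n \<le> lbar \<and> 0 < theta n \<and> theta n \<le> 1" for n
  proof (induction n)
    case 0
    then show ?case using lam0 run(5,6) by (simp add: capped_ratio_le)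
  next
    case (Suc n)
    then show ?case using step(3-6)[of n] by blast
  qed
  interpret reflected_gradient C F L alpha lbar x y lam theta
  proof
    show "\<exists>c>0. \<exists>\<^sub>F n in sequentially. c \<le> lam n"
      using inv step(9) run(1) assms(5)
      by (intro frequently_ge_if_weakly_bounded_decrease[of lam "alpha / L"]) auto
    \<comment> \<open>The case of index 0 is Step 1 of the algorithm, the others are its
      iterations.\<close>
    show "x (Suc n) = metric_proj C (x n - lam n *\<^sub>R F (y n))" for n
      using run(7) step(1) inv by (cases n) auto
  qed (use assms lip run inv step(2,7,8) in auto)
  show ?thesis by (rule weak_convergence)
qed

end
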